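(* Let $\mathcal{F}=\{\phi_j\}_{j=1}^m\subseteq\mathbb{C}^d$ be a frame for $\mathbb{C}^d$, let $S=S^{\mathcal{F}}$ be its frame operator, and assume that $\mathcal{F}$ cannot be partitioned into two (nonempty) mutually orthogonal sets of vectors. Let $\{S_i\}_{i\in\mathbb{N}}\subseteq\mathcal{M}_d(\mathbb{C})^+$ be a sequence converging to $S$. Then for every $\eta>0$ there exists $i_1\in\mathbb{N}$ such that for each $i\ge i_1$ there exists a frame $\mathcal{G}=\mathcal{G}(i)=\{\psi_j\}_{j=1}^m$ such that: (1) $\|\psi_j\|=\|\phi_j\|$ for $1\le j\le m$; (2) $\|\psi_j-\phi_j\|\le\eta$ for $1\le j\le m$; (3) $S^{\mathcal{G}}=S_i$.
   Context: $\mathcal{M}_d(\mathbb{C})^+$ denotes the set of positive semidefinite $d\times d$ complex matrices. A finite sequence in $\mathbb{C}^d$ is a frame for $\mathbb{C}^d$ if and only if it spans $\mathbb{C}^d$. For a finite sequence $\mathcal{F}=\{\phi_j\}_{j=1}^m\subset\mathbb{C}^d$, the synthesis operator is $T^{\mathcal{F}}:\mathbb{C}^m\to\mathbb{C}^d$, sending the $j$-th canonical basis vector to $\phi_j$, and the frame operator is $S^{\mathcal{F}}=T^{\mathcal{F}}(T^{\mathcal{F}})^*$. "Cannot be partitioned into two mutually orthogonal sets of vectors" means: there is no $\emptyset\ne J\subsetneq\{1,\dots,m\}$ with $\langle\phi_j,\phi_k\rangle=0$ for all $j\in J$, $k\notin J$.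
   Formalization: The matrices S_i are additionally assumed to satisfy tr(S_i) = tr(S) for all i; without this the claim fails (d = m = 1, φ_1 = 1, S_i = 1 + 1/(i+1)), since (1) and (3) force the traces to agree. *)

theory Defs
  imports "HOL-Analysis.Analysis"
begin

text \<open>
  Vectors of \<open>C^d\<close> are elements of \<open>complex ^ 'd\<close>, with \<open>d = CARD('d) \<ge> 1\<close>.  The library's
  inner product on this type is the real one, so the Hermitian inner product is
  defined here, linear in its first argument.  The library's norm on \<open>complex ^ 'd\<close> is the
  Euclidean norm that belongs to it (lemma \<open>cinner_self\<close>).
\<close>

definition cinner :: "complex ^ 'd \<Rightarrow> complex ^ 'd \<Rightarrow> complex" where
  "cinner x y = (\<Sum>i\<in>UNIV. x $ i * cnj (y $ i))"

lemma cinner_self: "cinner x x = complex_of_real ((norm x)\<^sup>2)"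
proof -
  have "cinner x x = complex_of_real (\<Sum>i\<in>UNIV. (norm (x $ i))\<^sup>2)"
    unfolding cinner_def of_real_sum by (intro sum.cong refl) (simp add: complex_norm_square[symmetric])
  then show ?thesis
    by (simp add: norm_vec_def L2_set_def sum_nonneg)
qed

definition conj_transpose :: "complex ^ 'n ^ 'm \<Rightarrow> complex ^ 'm ^ 'n" where
  "conj_transpose A = (\<chi> i j. cnj (A $ j $ i))"

lemma cinner_conj_transpose: "cinner (A *v x) y = cinner x (conj_transpose A *v y)"
  unfolding cinner_def conj_transpose_def matrix_vector_mult_def
  by (simp add: sum_distrib_left sum_distrib_right mult_ac) (rule sum.swap)

definition pos_semidef :: "complex ^ 'd ^ 'd \<Rightarrow> bool" where
  "pos_semidef A \<longleftrightarrow> conj_transpose A = A \<and> (\<forall>x. 0 \<le> Re (cinner (A *v x) x))"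

text \<open>
  A sequence of \<open>m\<close> vectors is a family indexed by a finite type \<open>'m\<close> with \<open>m = CARD('m)\<close>.
  This excludes only \<open>m = 0\<close>, where nothing spans \<open>C^d\<close>.  In finite dimension
  a family is a frame iff it spans; \<open>vec.span\<close> is the span over the complex scalars, whereas
  \<open>span\<close> would be the one over the reals.
\<close>

definition is_frame :: "('m::finite \<Rightarrow> complex ^ 'd) \<Rightarrow> bool" where
  "is_frame \<phi> \<longleftrightarrow> vec.span (range \<phi>) = UNIV"

definition synthesis :: "('m::finite \<Rightarrow> complex ^ 'd) \<Rightarrow> complex ^ 'm ^ 'd" where
  "synthesis \<phi> = (\<chi> i j. \<phi> j $ i)"

lemma synthesis_axis: "synthesis \<phi> *v axis j 1 = \<phi> j"
  by (simp add: synthesis_def matrix_vector_mult_def axis_def vec_eq_iff if_distrib cong: if_cong)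

definition frame_operator :: "('m::finite \<Rightarrow> complex ^ 'd) \<Rightarrow> complex ^ 'd ^ 'd" where
  "frame_operator \<phi> = synthesis \<phi> ** conj_transpose (synthesis \<phi>)"

definition orthogonally_partitionable :: "('m::finite \<Rightarrow> complex ^ 'd) \<Rightarrow> bool" where
  "orthogonally_partitionable \<phi> \<longleftrightarrow>
     (\<exists>J. J \<noteq> {} \<and> J \<noteq> UNIV \<and> (\<forall>j\<in>J. \<forall>k\<in>- J. cinner (\<phi> j) (\<phi> k) = 0))"

text \<open>
  The trace of a frame operator is determined by the norms of the vectors.  So a sequence
  of matrices can only be realised as frame operators of families with the norms of \<open>\<phi>\<close> if
  the matrices have the trace of \<open>frame_operator \<phi>\<close>.
\<close>

lemma trace_frame_operator:
  "trace (frame_operator \<phi>) = complex_of_real (\<Sum>j\<in>UNIV. (norm (\<phi> j))\<^sup>2)"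
proof -
  have "trace (frame_operator \<phi>) = (\<Sum>i\<in>UNIV. \<Sum>j\<in>UNIV. \<phi> j $ i * cnj (\<phi> j $ i))"
    by (simp add: trace_def frame_operator_def synthesis_def conj_transpose_def
        matrix_matrix_mult_def)
  also have "\<dots> = (\<Sum>j\<in>UNIV. cinner (\<phi> j) (\<phi> j))"
    unfolding cinner_def by (rule sum.swap)
  finally show ?thesis by (simp add: cinner_self)
qed

end

theory Submission
  imports Defs
begin

text \<open>
  Let \<open>\<Phi>\<close> send a family \<open>x\<close> of \<open>m\<close> vectors in \<open>C^d\<close> to its frame operator together with the
  squared norms of its vectors.  The theorem says that \<open>\<Phi>\<close> is open at \<open>\<phi>\<close> as a map into the space
  \<open>W\<close> of pairs \<open>(H, n)\<close> with \<open>H\<close> Hermitian and \<open>trace H = (\<Sum>j. n\<^sub>j)\<close>.  That follows from a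
  surjective derivative: a continuous map with this property at a point is open there, by
  Brouwer's fixed point theorem.

  The derivative is surjective onto \<open>W\<close> because a pair \<open>(A, c)\<close> in \<open>W\<close> that is orthogonal to its
  range satisfies \<open>A \<phi>\<^sub>j = - c\<^sub>j \<phi>\<^sub>j\<close> for all \<open>j\<close>.  Eigenvectors of a Hermitian matrix for different
  eigenvalues are orthogonal, so irreducibility makes all \<open>c\<^sub>j\<close> equal to one number \<open>r\<close>,
  and since the \<open>\<phi>\<^sub>j\<close> span, \<open>A = - r I\<close>.  Now \<open>(A, c) \<in> W\<close> reads \<open>- r d = r m\<close>, which leaves only
  \<open>r = 0\<close> (lemma \<open>derivative_complement_trivial\<close>).

  To work with a whole Euclidean space as codomain instead of the subspace \<open>W\<close>, a linear
  map \<open>slack\<close> with range \<open>W\<^sup>\<bottom>\<close> is added to \<open>\<Phi>\<close>, in new variables.  A value of the sum that lies in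
  \<open>W\<close> has zero slack (lemma \<open>slack_vanishes\<close>), so it is a value of \<open>\<Phi>\<close> itself.  The pairs
  \<open>(S\<^sub>i, (norm \<phi>\<^sub>j)\<^sup>2)\<close> lie in \<open>W\<close> and converge to \<open>\<Phi> \<phi>\<close>, so they are eventually values of \<open>\<Phi>\<close> at
  families near \<open>\<phi>\<close>.  Such a family is a frame because a family spans iff its frame operator has
  nonzero determinant, and the determinant is continuous.
\<close>

section \<open>Openness from a trivial orthogonal complement\<close>

text \<open>
  In Euclidean spaces a proper subspace has a nonzero vector orthogonal to it.  So the
  hypothesis on \<open>v\<close> says that the derivative is onto, in the form in which a
  computation of its adjoint delivers it.
\<close>

lemma open_at_if_derivative_complement_trivial:
  fixes f :: "'a::euclidean_space \<Rightarrow> 'b::euclidean_space"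
  assumes cont: "continuous_on UNIV f"
    and deriv: "(f has_derivative f') (at x)"
    and orth: "\<And>v. (\<And>h. v \<bullet> f' h = 0) \<Longrightarrow> v = 0"
    and x: "x \<in> interior T"
  shows "f x \<in> interior (f ` T)"
proof -
  have lin: "linear f'"
    using deriv by (rule has_derivative_linear)
  have "span (range f') = UNIV"
  proof (rule ccontr)
    assume "span (range f') \<noteq> UNIV"
    then obtain v where "v \<noteq> 0" "\<And>y. y \<in> span (range f') \<Longrightarrow> v \<bullet> y = 0"
      using span_not_UNIV_orthogonal by metis
    then show False
      using orth[of v] by (simp add: span_base)
  qed
  then have "surj f'"
    using lin by (metis linear_subspace_image span_eq_iff subspace_UNIV)
  then obtain g' where "linear g'" "f' \<circ> g' = id"
    using linear_surjective_right_inverse[OF lin] by blast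
  then show ?thesis
    using sussmann_open_mapping[OF open_UNIV cont UNIV_I deriv _ _ subset_UNIV x]
    by (simp add: linear_conv_bounded_linear)
qed

section \<open>Hermitian matrices and frame operators\<close>

lemma conj_transpose_component [simp]: "conj_transpose A $ i $ j = cnj (A $ j $ i)"
  by (simp add: conj_transpose_def)

lemma frame_operator_component:
  "frame_operator \<phi> $ a $ b = (\<Sum>j\<in>UNIV. \<phi> j $ a * cnj (\<phi> j $ b))"
  by (simp add: frame_operator_def synthesis_def matrix_matrix_mult_def)

lemma conj_transpose_frame_operator: "conj_transpose (frame_operator \<phi>) = frame_operator \<phi>"
  by (simp add: vec_eq_iff frame_operator_component mult.commute)

lemma inner_conj_transpose: "conj_transpose A \<bullet> B = A \<bullet> conj_transpose B"
  by (simp add: inner_vec_def inner_complex_def) (rule sum.swap)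

lemma inner_mat_1: "A \<bullet> mat 1 = Re (trace A)"
  by (simp add: inner_vec_def inner_complex_def mat_def trace_def if_distrib[of Re] if_distrib[of Im]
      if_distrib[of "\<lambda>x. _ * x"] sum.delta cong: if_cong)

lemma cinner_scaleR_left: "cinner (c *\<^sub>R x) y = complex_of_real c * cinner x y"
  unfolding cinner_def vector_scaleR_component
  by (simp add: sum_distrib_left scaleR_conv_of_real mult.assoc)

lemma cinner_scaleR_right: "cinner x (c *\<^sub>R y) = complex_of_real c * cinner x y"
  unfolding cinner_def vector_scaleR_component
  by (simp add: sum_distrib_left scaleR_conv_of_real mult_ac)

lemma hermitian_eigenvectors_orthogonal:
  assumes herm: "conj_transpose A = A"
    and x: "A *v x = a *\<^sub>R x" and y: "A *v y = b *\<^sub>R y" and "a \<noteq> b"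
  shows "cinner x y = 0"
proof -
  have "cinner (A *v x) y = cinner x (A *v y)"
    using cinner_conj_transpose[of A x y] herm by simp
  then show ?thesis
    using \<open>a \<noteq> b\<close> by (simp add: x y cinner_scaleR_left cinner_scaleR_right)
qed

lemma scaleR_mat_1_mult_vec: "(c *\<^sub>R mat 1) *v x = c *\<^sub>R x" for x :: "complex ^ 'd"
  by (simp add: vec_eq_iff matrix_vector_mult_def mat_def if_distrib[of "\<lambda>u. u * _"]
      if_distrib[of "\<lambda>u. c *\<^sub>R u"] cong: if_cong)

text \<open>
  The indices whose eigenvalue is a given one form a block that is orthogonal to
  the vectors of all other indices, so irreducibility leaves a single eigenvalue.
\<close>

lemma scalar_if_frame_of_eigenvectors:
  assumes frame: "is_frame \<phi>" and irreducible: "\<not> orthogonally_partitionable \<phi>"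
    and herm: "conj_transpose A = A"
    and eigen: "\<And>j. A *v \<phi> j = c j *\<^sub>R \<phi> j"
  obtains r where "A = r *\<^sub>R mat 1" "\<And>j. c j = r"
proof -
  define r where "r = c undefined"
  define J where "J = {k. c k = r}"
  have "\<forall>j\<in>J. \<forall>k\<in>- J. cinner (\<phi> j) (\<phi> k) = 0"
    using hermitian_eigenvectors_orthogonal[OF herm eigen eigen] by (auto simp: J_def)
  moreover have "undefined \<in> J"
    by (simp add: J_def r_def)
  ultimately have "J = UNIV"
    using irreducible unfolding orthogonally_partitionable_def by blast
  then have const: "c k = r" for k
    unfolding J_def by blast
  have "A *v x = (r *\<^sub>R mat 1) *v x" for x
  proof (rule vec.span_induct[of x "range \<phi>"])
    show "x \<in> vec.span (range \<phi>)"
      using frame by (simp add: is_frame_def)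
    show "vec.subspace {x. A *v x = (r *\<^sub>R mat 1) *v x}"
      by (auto simp: vec.subspace_def matrix_vector_right_distrib vector_scalar_commute)
    show "A *v x = (r *\<^sub>R mat 1) *v x" if "x \<in> range \<phi>" for x
      using that eigen const by (auto simp: scaleR_mat_1_mult_vec)
  qed
  then show ?thesis
    using const that by (simp add: matrix_eq)
qed

text \<open>
  This makes the kernel of the frame operator the orthogonal complement of the family, which
  is how spanning enters the determinant criterion below.
\<close>

lemma cinner_frame_operator:
  "cinner (frame_operator \<phi> *v x) x = complex_of_real (\<Sum>j\<in>UNIV. (cmod (cinner x (\<phi> j)))\<^sup>2)"
proof -
  let ?y = "conj_transpose (synthesis \<phi>) *v x"
  have component: "?y $ j = cinner x (\<phi> j)" for j
    by (simp add: matrix_vector_mult_def synthesis_def cinner_def mult.commute)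
  have "cinner (frame_operator \<phi> *v x) x = cinner ?y ?y"
    by (simp add: frame_operator_def cinner_conj_transpose flip: matrix_vector_mul_assoc)
  also have "\<dots> = complex_of_real (\<Sum>j\<in>UNIV. (cmod (cinner x (\<phi> j)))\<^sup>2)"
    by (simp add: cinner_self norm_vec_def L2_set_def sum_nonneg component)
  finally show ?thesis .
qed

lemma is_frame_iff_det_frame_operator: "is_frame \<phi> \<longleftrightarrow> det (frame_operator \<phi>) \<noteq> 0"
proof
  assume frame: "is_frame \<phi>"
  have "x = 0" if "frame_operator \<phi> *v x = 0" for x
  proof -
    have "(\<Sum>j\<in>UNIV. (cmod (cinner x (\<phi> j)))\<^sup>2) = 0"
      using cinner_frame_operator[of \<phi> x] that by (simp add: cinner_def del: of_real_sum)
    then have 0: "cinner x (\<phi> j) = 0" for j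
      by (simp add: sum_nonneg_eq_0_iff)
    have "cinner x y = 0" for y
    proof (rule vec.span_induct[of y "range \<phi>"])
      show "y \<in> vec.span (range \<phi>)"
        using frame by (simp add: is_frame_def)
      show "vec.subspace {y. cinner x y = 0}"
        by (auto simp: vec.subspace_def cinner_def distrib_left sum.distrib mult.left_commute
            simp flip: sum_distrib_left)
    qed (use 0 in auto)
    then show "x = 0"
      using cinner_self[of x] by simp
  qed
  then have "\<exists>B. B ** frame_operator \<phi> = mat 1"
    by (simp add: matrix_left_invertible_ker)
  then show "det (frame_operator \<phi>) \<noteq> 0"
    using invertible_det_nz invertible_left_inverse by blast
next
  assume "det (frame_operator \<phi>) \<noteq> 0"
  then obtain B where B: "frame_operator \<phi> ** B = mat 1"
    using invertible_det_nz invertible_right_inverse by blast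
  have "x \<in> vec.span (range \<phi>)" for x
  proof -
    define y where "y = conj_transpose (synthesis \<phi>) *v (B *v x)"
    have "x = synthesis \<phi> *v y"
      using B by (simp add: y_def frame_operator_def matrix_vector_mul_assoc matrix_mul_assoc)
    also have "\<dots> = (\<Sum>j\<in>UNIV. y $ j *s \<phi> j)"
      by (simp add: vec_eq_iff matrix_vector_mult_def synthesis_def mult.commute)
    also have "\<dots> \<in> vec.span (range \<phi>)"
      by (intro vec.span_sum vec.span_scale vec.span_base) auto
    finally show ?thesis .
  qed
  then show "is_frame \<phi>"
    by (auto simp: is_frame_def)
qed

lemma tendsto_det:
  fixes A :: "nat \<Rightarrow> complex ^ 'n ^ 'n"
  assumes "A \<longlonglongrightarrow> L"
  shows "(\<lambda>i. det (A i)) \<longlonglongrightarrow> det L"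
  unfolding det_def by (intro tendsto_intros tendsto_vec_nth assms)

section \<open>Frame operator and norms as one quadratic map\<close>

text \<open>
  A real bilinear form with frame operator and squared norms on its diagonal.  The
  derivative of this quadratic map is then obtained from the product rule.
\<close>

definition polar_form :: "complex ^ 'd ^ 'm \<Rightarrow> complex ^ 'd ^ 'm \<Rightarrow> (complex ^ 'd ^ 'd) \<times> (real ^ 'm)" where
  "polar_form x y = ((\<chi> a b. \<Sum>j\<in>UNIV. x $ j $ a * cnj (y $ j $ b)), (\<chi> j. x $ j \<bullet> y $ j))"

text \<open>
  The range is the orthogonal complement of the pairs \<open>(H, n)\<close> with \<open>H\<close> Hermitian and
  \<open>trace H = (\<Sum>j. n\<^sub>j)\<close>: the first summand accounts for the Hermitian condition and the multiples
  of \<open>(I, - 1)\<close> for the trace condition.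
\<close>

definition slack :: "(complex ^ 'd ^ 'd) \<times> real \<Rightarrow> (complex ^ 'd ^ 'd) \<times> (real ^ 'm)" where
  "slack = (\<lambda>(K, t). (K - conj_transpose K + t *\<^sub>R mat 1, - (\<chi> j. t)))"

lemma polar_form_self: "polar_form x x = (frame_operator (($) x), \<chi> j. (norm (x $ j))\<^sup>2)"
  by (simp add: polar_form_def vec_eq_iff frame_operator_component dot_square_norm)

lemma bounded_bilinear_polar_form: "bounded_bilinear polar_form"
  unfolding bilinear_conv_bounded_bilinear[symmetric] bilinear_def
  by (auto intro!: linearI simp: polar_form_def vec_eq_iff algebra_simps sum.distrib
      scaleR_sum_right)

lemma linear_slack: "linear slack"
  by (auto intro!: linearI simp: slack_def vec_eq_iff algebra_simps)

text \<open>
  The adjoint of \<open>h \<mapsto> polar_form h x\<close>, computed for the real inner product.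
\<close>

lemma inner_polar_form_left: "(A, c) \<bullet> polar_form h x = (\<Sum>j\<in>UNIV. (A *v x $ j + c $ j *\<^sub>R x $ j) \<bullet> h $ j)"
proof -
  have complex: "u \<bullet> (v * cnj w) = (u * w) \<bullet> v" for u v w :: complex
    by (simp add: inner_complex_def algebra_simps)
  have "A \<bullet> fst (polar_form h x) = (\<Sum>a\<in>UNIV. \<Sum>b\<in>UNIV. \<Sum>j\<in>UNIV. (A $ a $ b * x $ j $ b) \<bullet> h $ j $ a)"
    by (simp add: polar_form_def inner_vec_def inner_sum_right complex)
  also have "\<dots> = (\<Sum>a\<in>UNIV. \<Sum>j\<in>UNIV. \<Sum>b\<in>UNIV. (A $ a $ b * x $ j $ b) \<bullet> h $ j $ a)"
    by (intro sum.cong refl sum.swap)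
  also have "\<dots> = (\<Sum>j\<in>UNIV. \<Sum>a\<in>UNIV. \<Sum>b\<in>UNIV. (A $ a $ b * x $ j $ b) \<bullet> h $ j $ a)"
    by (rule sum.swap)
  also have "\<dots> = (\<Sum>j\<in>UNIV. (A *v x $ j) \<bullet> h $ j)"
    by (simp add: inner_vec_def[where 'a = complex] matrix_vector_mult_def inner_sum_left)
  finally have "A \<bullet> fst (polar_form h x) = (\<Sum>j\<in>UNIV. (A *v x $ j) \<bullet> h $ j)" .
  moreover have "c \<bullet> snd (polar_form h x) = (\<Sum>j\<in>UNIV. (c $ j *\<^sub>R x $ j) \<bullet> h $ j)"
    unfolding polar_form_def snd_conv
    by (subst inner_vec_def) (simp add: inner_commute)
  ultimately show ?thesis
    by (simp add: inner_prod_def inner_add_left sum.distrib)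
qed

lemma inner_polar_form_right: 
  "(A, c) \<bullet> polar_form x h = (conj_transpose A, c) \<bullet> polar_form h x"
proof -
  have "fst (polar_form x h) = conj_transpose (fst (polar_form h x))"
    by (simp add: polar_form_def vec_eq_iff mult.commute)
  moreover have "snd (polar_form x h) = snd (polar_form h x)"
    by (simp add: polar_form_def vec_eq_iff inner_commute)
  ultimately show ?thesis
    by (simp add: inner_prod_def inner_conj_transpose)
qed

lemma inner_slack:
  "(A, c) \<bullet> slack (K, t) = (A - conj_transpose A) \<bullet> K + t * (Re (trace A) - (\<Sum>j\<in>UNIV. c $ j))"
proof -
  have "c \<bullet> (\<chi> j. t) = t * (\<Sum>j\<in>UNIV. c $ j)"
    by (simp add: inner_vec_def sum_distrib_left mult.commute)
  then show ?thesis
    by (simp add: slack_def inner_prod_def inner_conj_transpose inner_mat_1 algebra_simps)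
qed

text \<open>
  Testing with the slack variables puts \<open>v = (A, c)\<close> into the space of Hermitian matrices paired
  with numbers of the right sum; testing with \<open>h\<close> gives \<open>A x\<^sub>j = - c\<^sub>j x\<^sub>j\<close>.
\<close>

lemma derivative_complement_trivial:
  fixes x :: "complex ^ 'd ^ 'm" and v :: "(complex ^ 'd ^ 'd) \<times> (real ^ 'm)"
  assumes frame: "is_frame (($) x)" and irreducible: "\<not> orthogonally_partitionable (($) x)"
    and orth: "\<And>h z. v \<bullet> (polar_form x h + polar_form h x + slack z) = 0"
  shows "v = 0"
proof -
  obtain A c where v: "v = (A, c)"
    by fastforce
  have slack: "(A, c) \<bullet> slack z = 0" for z
    using orth[of 0 z]
    by (simp add: v bounded_bilinear.zero_left[OF bounded_bilinear_polar_form]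
        bounded_bilinear.zero_right[OF bounded_bilinear_polar_form])
  have "(A - conj_transpose A) \<bullet> (A - conj_transpose A) = 0"
    using slack[of "(A - conj_transpose A, 0)"] by (simp add: inner_slack)
  then have herm: "conj_transpose A = A"
    by simp
  have trace: "Re (trace A) = (\<Sum>j\<in>UNIV. c $ j)"
    using slack[of "(0, 1)"] by (simp add: inner_slack)
  \<comment> \<open>Up to a factor 2, this is the adjoint of the derivative applied to \<open>(A, c)\<close>; as a test
    direction it produces its own squared norm.\<close>
  define h where "h = (\<chi> j. A *v x $ j + c $ j *\<^sub>R x $ j)"
  have "(A, c) \<bullet> polar_form h x = 0"
    using orth[of h 0] slack[of 0]
    by (simp add: v inner_simps inner_polar_form_right[of A c x h] herm)
  then have "(\<Sum>j\<in>UNIV. h $ j \<bullet> h $ j) = 0"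
    by (simp add: inner_polar_form_left h_def)
  then have "h $ j = 0" for j
    by (simp add: sum_nonneg_eq_0_iff)
  then have "A *v x $ j = (- c $ j) *\<^sub>R x $ j" for j
    by (simp add: h_def eq_neg_iff_add_eq_0)
  then obtain r' where r': "A = r' *\<^sub>R mat 1" "\<And>j. - c $ j = r'"
    using scalar_if_frame_of_eigenvectors[OF frame irreducible herm, of "\<lambda>j. - c $ j"] by metis
  define r where "r = - r'"
  have A: "A = - r *\<^sub>R mat 1" and c: "c $ k = r" for k
    using r'(1) r'(2)[of k] by (auto simp: r_def)
  \<comment> \<open>The trace relation alone would allow \<open>A = I\<close> with all \<open>c\<^sub>j = d / m\<close>; the eigenvector relation
    forces \<open>A\<close> and \<open>c\<close> to have opposite signs, so only zero is left.\<close>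
  have "- r * CARD('d) = r * CARD('m)"
    using trace by (simp add: A c trace_def mat_def)
  then have "r * (real CARD('d) + real CARD('m)) = 0"
    by (simp add: algebra_simps)
  moreover have "real CARD('d) + real CARD('m) \<noteq> 0"
    using zero_less_card_finite[where 'a = 'd] by linarith
  ultimately have "r = 0"
    by (metis mult_eq_0_iff)
  then show "v = 0"
    by (simp add: v A c vec_eq_iff zero_prod_def)
qed

text \<open>
  The slack is orthogonal both to the target and to the value of the quadratic map, hence to
  their difference, which is the slack itself.
\<close>

lemma slack_vanishes:
  assumes eq: "polar_form x x + slack z = (H, c)"
    and herm: "conj_transpose H = H" and trace: "Re (trace H) = (\<Sum>j\<in>UNIV. c $ j)"
  shows "polar_form x x = (H, c)"
proof -
  define s where "s = (H, c) - polar_form x x"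
  have s: "s = slack z"
    by (simp add: s_def flip: eq)
  have "polar_form x x \<bullet> slack z = 0"
    by (cases z) (simp add: polar_form_self inner_slack conj_transpose_frame_operator trace_frame_operator)
  moreover have "(H, c) \<bullet> slack z = 0"
    by (cases z) (simp add: inner_slack herm trace)
  ultimately have "s \<bullet> s = 0"
    by (subst (2) s) (simp add: s_def inner_diff_left)
  then show ?thesis
    by (simp add: s_def)
qed

lemma open_at_irreducible_frame:
  fixes x :: "complex ^ 'd ^ 'm"
  assumes "is_frame (($) x)" and "\<not> orthogonally_partitionable (($) x)" and "0 < \<eta>"
  shows "polar_form x x \<in> interior ((\<lambda>(y, z). polar_form y y + slack z) ` ball (x, 0) \<eta>)"
proof -
  define f :: "(complex ^ 'd ^ 'm) \<times> (complex ^ 'd ^ 'd) \<times> real \<Rightarrow> (complex ^ 'd ^ 'd) \<times> (real ^ 'm)"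
    where "f = (\<lambda>p. polar_form (fst p) (fst p) + slack (snd p))"
  have bl: "bounded_linear slack"
    using linear_slack by (simp add: linear_conv_bounded_linear)
  have deriv: "(f has_derivative
      (\<lambda>q. polar_form (fst p) (fst q) + polar_form (fst q) (fst p) + slack (snd q))) (at p)" for p
    unfolding f_def
    by (intro has_derivative_add bounded_bilinear.FDERIV[OF bounded_bilinear_polar_form]
        bounded_linear.has_derivative[OF bl] has_derivative_fst has_derivative_snd has_derivative_ident)
  have "f (x, 0) \<in> interior (f ` ball (x, 0) \<eta>)"
  proof (rule open_at_if_derivative_complement_trivial[OF _ deriv])
    show "continuous_on UNIV f"
      using deriv has_derivative_continuous by (blast intro: continuous_at_imp_continuous_on)
    show "v = 0" if "\<And>q. v \<bullet> (polar_form (fst (x, 0)) (fst q) + polar_form (fst q) (fst (x, 0)) + slack (snd q)) = 0"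
      for v
      using derivative_complement_trivial[OF assms(1,2)] that[of "(_, _)"] by simp
    show "(x, 0) \<in> interior (ball (x, 0) \<eta>)"
      using \<open>0 < \<eta>\<close> by simp
  qed
  moreover have "f (x, 0) = polar_form x x"
    using linear_0[OF linear_slack] by (simp add: f_def)
  moreover have "f = (\<lambda>(y, z). polar_form y y + slack z)"
    by (auto simp: f_def)
  ultimately show ?thesis
    by simp
qed

theorem proposition5p3:
  fixes \<phi> :: "'m::finite \<Rightarrow> complex ^ 'd"
    and S :: "nat \<Rightarrow> complex ^ 'd ^ 'd"
  assumes frame: "is_frame \<phi>"
    and irreducible: "\<not> orthogonally_partitionable \<phi>"
    and psd: "\<And>i. pos_semidef (S i)"
    and same_trace: "\<And>i. trace (S i) = trace (frame_operator \<phi>)"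
    and lim: "S \<longlonglongrightarrow> frame_operator \<phi>"
  shows "\<forall>\<eta>>0. \<exists>i\<^sub>1. \<forall>i\<ge>i\<^sub>1. \<exists>\<psi> :: 'm \<Rightarrow> complex ^ 'd.
           is_frame \<psi> \<and>
           (\<forall>j. norm (\<psi> j) = norm (\<phi> j)) \<and>
           (\<forall>j. norm (\<psi> j - \<phi> j) \<le> \<eta>) \<and>
           frame_operator \<psi> = S i"
proof (intro allI impI)
  fix \<eta> :: real
  assume "\<eta> > 0"
  define x where "x = (\<chi> j. \<phi> j)"
  define n where "n = (\<chi> j. (norm (\<phi> j))\<^sup>2)"
  have x: "($) x = \<phi>"
    by (auto simp: x_def)
  define U where "U = interior ((\<lambda>(y, z). polar_form y y + slack z) ` ball (x, 0) \<eta>)"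
  have "polar_form x x \<in> U"
    using open_at_irreducible_frame[of x \<eta>] frame irreducible \<open>\<eta> > 0\<close> by (simp add: x U_def)
  moreover have "polar_form x x = (frame_operator \<phi>, n)"
    unfolding polar_form_self x n_def ..
  moreover have "(\<lambda>i. (S i, n)) \<longlonglongrightarrow> (frame_operator \<phi>, n)"
    by (intro tendsto_Pair lim tendsto_const)
  moreover have "open U"
    by (simp add: U_def)
  ultimately have "\<forall>\<^sub>F i in sequentially. (S i, n) \<in> U"
    using topological_tendstoD[of "\<lambda>i. (S i, n)" "(frame_operator \<phi>, n)" sequentially U] by simp
  moreover have "\<forall>\<^sub>F i in sequentially. det (S i) \<noteq> 0"
    using tendsto_imp_eventually_ne[OF tendsto_det[OF lim]] frame is_frame_iff_det_frame_operator
    by blast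
  ultimately have "\<forall>\<^sub>F i in sequentially. (S i, n) \<in> U \<and> det (S i) \<noteq> 0"
    by (rule eventually_conj)
  then obtain i\<^sub>1 where i\<^sub>1: "\<And>i. i \<ge> i\<^sub>1 \<Longrightarrow> (S i, n) \<in> U \<and> det (S i) \<noteq> 0"
    unfolding eventually_sequentially by blast
  show "\<exists>i\<^sub>1. \<forall>i\<ge>i\<^sub>1. \<exists>\<psi> :: 'm \<Rightarrow> complex ^ 'd. is_frame \<psi> \<and> (\<forall>j. norm (\<psi> j) = norm (\<phi> j)) \<and>
      (\<forall>j. norm (\<psi> j - \<phi> j) \<le> \<eta>) \<and> frame_operator \<psi> = S i"
  proof (rule exI[of _ i\<^sub>1], intro allI impI)
    fix i assume "i \<ge> i\<^sub>1"
    then obtain y z where near: "(y, z) \<in> ball (x, 0) \<eta>" and eq: "polar_form y y + slack z = (S i, n)"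
      using i\<^sub>1[of i] interior_subset unfolding U_def by force
    have "conj_transpose (S i) = S i"
      using psd by (simp add: pos_semidef_def)
    moreover have "Re (trace (S i)) = (\<Sum>j\<in>UNIV. n $ j)"
      by (simp add: same_trace trace_frame_operator n_def)
    ultimately have val: "polar_form y y = (S i, n)"
      using slack_vanishes[OF eq] by blast
    then have op: "frame_operator (($) y) = S i" and norms: "(norm (y $ j))\<^sup>2 = (norm (\<phi> j))\<^sup>2" for j
      using val by (auto simp: polar_form_self n_def vec_eq_iff)
    have "norm (y $ j - \<phi> j) \<le> \<eta>" for j
    proof -
      have "norm (y $ j - \<phi> j) \<le> norm (y - x)"
        using Finite_Cartesian_Product.norm_nth_le[of "y - x" j] by (simp add: x_def)
      also have "\<dots> \<le> dist (x, 0) (y, z)"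
        using dist_fst_le[of "(x, 0)" "(y, z)"] by (simp add: dist_norm norm_minus_commute)
      also have "\<dots> \<le> \<eta>"
        using near by simp
      finally show ?thesis .
    qed
    moreover have "is_frame (($) y)"
      using i\<^sub>1[OF \<open>i \<ge> i\<^sub>1\<close>] op by (simp add: is_frame_iff_det_frame_operator)
    moreover have "norm (y $ j) = norm (\<phi> j)" for j
      using norms[of j] by simp
    ultimately show "\<exists>\<psi> :: 'm \<Rightarrow> complex ^ 'd. is_frame \<psi> \<and> (\<forall>j. norm (\<psi> j) = norm (\<phi> j)) \<and>
        (\<forall>j. norm (\<psi> j - \<phi> j) \<le> \<eta>) \<and> frame_operator \<psi> = S i"
      using op by (intro exI[of _ "($) y"]) blast
  qed
qed

end
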